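(* For each integer $N\ge1$ let $S_N$ be the weighted set of similarity classes (points of $\mathcal{M}_\Delta$) of lattice triangles with vertices in $[-N,N]\times[-N,N]$, counted with multiplicity. Then the sequence $(S_N)_{N\ge1}$ does not equidistribute in $\mathcal{M}_\Delta$; that is, the normalized measures $\frac{1}{w(S_N)}\delta_{S_N}$ do not converge, as $N\to\infty$, to the uniform (normalized area) measure $\mu/\mu(\mathcal{M}_\Delta)$ on $\mathcal{M}_\Delta$.
   Context: A lattice triangle is a (nondegenerate) triangle in $\mathbb{R}^2$ whose three vertices lie in $\mathbb{Z}^2$; it is determined by its (unordered) set of vertices. The moduli space of triangles $\mathcal{M}_\Delta$ is the set of triangles in $\mathbb{R}^2$ up to similarity (composition of a translation, rotation and/or reflection with a scaling). Using side-lengths normalized to have sum $2$, it is identified with $$\{(a,b,c)\in\mathbb{R}^3 : a,b,c>0,\ a\le b\le c<1,\ a+b+c=2\},$$ and, by projecting to the first two coordinates (with $c=2-a-b$), with the planar region $$\mathcal{M}_\Delta=\{(a,b)\in\mathbb{R}^2 : 0<a\le b,\ a+2b\le 2,\ a+b>1\}.$$ Let $\mu$ be the area (two-dimensional Lebesgue) measure on this planar region. A lattice triangle $\Delta$ with vertices $A,B,C$ determines the point $p(\Delta)=(a,b)\in\mathcal{M}_\Delta$, where $a\le b\le c$ are the three numbers $\frac1s\lVert B-A\rVert$, $\frac1s\lVert C-B\rVert$, $\frac1s\lVert A-C\rVert$ listed in non-decreasing order, with $\lVert\cdot\rVert$ the Euclidean norm and $s=\frac12(\lVert B-A\rVert+\lVert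 C-B\rVert+\lVert A-C\rVert)$. A finite weighted set $S$ in a planar set $X$ is a finite subset $\{p_1,\dots,p_n\}\subset X$ of distinct points with positive integer weights $w_1,\dots,w_n$; its total weight is $w(S)=\sum_i w_i$, and its Dirac measure is $\delta_S=\sum_i w_i\delta_{p_i}$, where $\delta_p(A)=1$ if $p\in A$ and $0$ otherwise. For $N\ge1$, $S_N$ is the weighted set whose points are the points $p(\Delta)$, for $\Delta$ a lattice triangle with vertices in $[-N,N]^2$, the weight of a point $p$ being the number of lattice triangles $\Delta$ with vertices in $[-N,N]^2$ such that $p(\Delta)=p$. A sequence $(S_n)$ of finite weighted subsets of a planar set $X\subset\mathbb{R}^2$ with area measure $\mu$ (with $w(S_n)\to\infty$) equidistributes in $X$ if $$\frac{1}{w(S_n)}\delta_{S_n}(R)\to\frac{\mu(R)}{\mu(X)}\quad\text{as } n\to\infty$$ for every domain $R\subset X$; here a domain means a Borel subset of $X$ whose topological boundary has area zero. *)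

theory Defs
  imports "HOL-Analysis.Analysis" "HOL-Library.Multiset"
begin

text \<open>
  The plane is \<^typ>\<open>real \<times> real\<close>, whose \<^const>\<open>norm\<close> is the Euclidean one.  Area is
  \<^const>\<open>lborel\<close>.
\<close>

definition moduli_triangles :: "(real \<times> real) set" where
  "moduli_triangles = {(a, b). 0 < a \<and> a \<le> b \<and> a + 2 * b \<le> 2 \<and> a + b > 1}"

definition lattice_triangle :: "(real \<times> real) set \<Rightarrow> bool" where
  "lattice_triangle T \<longleftrightarrow>
     (\<exists>A B C. T = {A, B, C}) \<and> T \<subseteq> \<int> \<times> \<int> \<and> \<not> collinear T"

definition side_point :: "real \<times> real \<Rightarrow> real \<times> real \<Rightarrow> real \<times> real \<Rightarrow> real \<times> real" where
  "side_point A B C =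
     (let s = (norm (B - A) + norm (C - B) + norm (A - C)) / 2;
          l = sort [norm (B - A) / s, norm (C - B) / s, norm (A - C) / s]
      in (l ! 0, l ! 1))"

definition moduli_point :: "(real \<times> real) set \<Rightarrow> real \<times> real" where
  "moduli_point T = (THE p. \<exists>A B C. T = {A, B, C} \<and> p = side_point A B C)"

definition lattice_triangles_upto :: "nat \<Rightarrow> (real \<times> real) set set" where
  "lattice_triangles_upto N =
     {T. lattice_triangle T \<and> T \<subseteq> {- real N..real N} \<times> {- real N..real N}}"

text \<open>
  A finite weighted set is a multiset \<open>S\<close>: its points are \<^term>\<open>set_mset S\<close>, the weight of \<open>p\<close> is
  \<^term>\<open>count S p\<close>, and the total weight is \<^term>\<open>size S\<close>.
\<close>

definition triangle_classes :: "nat \<Rightarrow> (real \<times> real) multiset" where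
  "triangle_classes N = image_mset moduli_point (mset_set (lattice_triangles_upto N))"

definition dirac_measure :: "'a multiset \<Rightarrow> 'a set \<Rightarrow> real" where
  "dirac_measure S A = (\<Sum>p\<in>set_mset S. real (count S p) * indicator A p)"

definition planar_domain :: "(real \<times> real) set \<Rightarrow> (real \<times> real) set \<Rightarrow> bool" where
  "planar_domain X R \<longleftrightarrow> R \<in> sets borel \<and> R \<subseteq> X \<and> frontier R \<in> null_sets lborel"

text \<open>
  The standing requirements on the sequence, \<^prop>\<open>\<forall>n. set_mset (S n) \<subseteq> X\<close> and
  \<^term>\<open>size (S n)\<close> tending to infinity, are not conjuncts of the following definition, so that
  its negation says exactly that the convergence fails; for \<^const>\<open>triangle_classes\<close> they are
  proved below.
\<close>

definition equidistributes :: "(nat \<Rightarrow> (real \<times> real) multiset) \<Rightarrow> (real \<times> real) set \<Rightarrow> bool" where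
  "equidistributes S X \<longleftrightarrow>
     (\<forall>R. planar_domain X R \<longrightarrow>
        (\<lambda>n. 1 / real (size (S n)) * dirac_measure (S n) R)
          \<longlonglongrightarrow> measure lborel R / measure lborel X)"

lemma side_point_perm:
  shows "side_point B A C = side_point A B C" "side_point A C B = side_point A B C"
proof -
  have eq: "sort xs = sort ys" if "mset xs = mset ys" for xs ys :: "real list"
    using that by (metis mset_sort properties_for_sort sorted_sort)
  show "side_point B A C = side_point A B C"
    unfolding side_point_def Let_def
    by (subst eq[of _ "[norm (B - A) / ((norm (B - A) + norm (C - B) + norm (A - C)) / 2),
          norm (C - B) / ((norm (B - A) + norm (C - B) + norm (A - C)) / 2),
          norm (A - C) / ((norm (B - A) + norm (C - B) + norm (A - C)) / 2)]"])
       (simp_all add: norm_minus_commute add_ac)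
  show "side_point A C B = side_point A B C"
    unfolding side_point_def Let_def
    by (subst eq[of _ "[norm (B - A) / ((norm (B - A) + norm (C - B) + norm (A - C)) / 2),
          norm (C - B) / ((norm (B - A) + norm (C - B) + norm (A - C)) / 2),
          norm (A - C) / ((norm (B - A) + norm (C - B) + norm (A - C)) / 2)]"])
       (simp_all add: norm_minus_commute add_ac)
qed

lemma moduli_point_eq:
  assumes "\<not> collinear {A, B, C}"
  shows "moduli_point {A, B, C} = side_point A B C"
  unfolding moduli_point_def
proof (rule the_equality)
  fix p assume "\<exists>A' B' C'. {A, B, C} = {A', B', C'} \<and> p = side_point A' B' C'"
  then obtain A' B' C' where e: "{A, B, C} = {A', B', C'}" and p: "p = side_point A' B' C'"
    by blast
  have "A \<noteq> B" "A \<noteq> C" "B \<noteq> C"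
    using assms by (auto simp: insert_commute)
  with e have "(A', B', C') \<in> {(A,B,C), (A,C,B), (B,A,C), (B,C,A), (C,A,B), (C,B,A)}"
    unfolding set_eq_iff insert_iff empty_iff prod.inject by metis
  moreover have "side_point A C B = side_point A B C" "side_point B A C = side_point A B C"
    "side_point B C A = side_point A B C" "side_point C A B = side_point A B C"
    "side_point C B A = side_point A B C"
    using side_point_perm by metis+
  ultimately show "p = side_point A B C"
    unfolding p insert_iff empty_iff prod.inject by (elim disjE conjE FalseE) (simp_all only:)
qed blast

lemma moduli_point_in_moduli:
  assumes "lattice_triangle T"
  shows "moduli_point T \<in> moduli_triangles"
proof -
  from assms obtain A B C where T: "T = {A, B, C}" and nc: "\<not> collinear {A, B, C}"
    unfolding lattice_triangle_def by auto
  have tri: "dist x z < dist x y + dist y z" if "{x, y, z} = {A, B, C}" for x y z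
  proof -
    have "\<not> between (x, z) y"
      using nc between_imp_collinear[of x z y] that by (auto simp: insert_commute)
    then show ?thesis
      using dist_triangle[of x z y] unfolding between by (simp add: dist_commute)
  qed
  define u v w where "u = norm (B - A)" and "v = norm (C - B)" and "w = norm (A - C)"
  have 1: "u < v + w" "v < u + w" "w < u + v"
    using tri[of A C B] tri[of B A C] tri[of C B A]
    by (auto simp: u_def v_def w_def dist_norm norm_minus_commute insert_commute)
  have pos: "u > 0" "v > 0" "w > 0"
    using 1 norm_ge_zero[of "B - A"] by linarith+
  define s where "s = (u + v + w) / 2"
  have s: "s > 0" using pos by (simp add: s_def)
  define a b c where "a = u / s" and "b = v / s" and "c = w / s"
  have sum: "a + b + c = 2"
  proof -
    have "a + b + c = (u + v + w) / s"
      by (simp add: a_def b_def c_def add_divide_distrib)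
    also have "u + v + w = 2 * s"
      by (simp add: s_def)
    finally show ?thesis
      using s by simp
  qed
  have "a > 0" "b > 0" "c > 0" "a < b + c" "b < a + c" "c < a + b"
    using 1 pos s by (simp_all add: a_def b_def c_def add_divide_distrib[symmetric]
        divide_strict_right_mono)
  moreover have "side_point A B C = (sort [a, b, c] ! 0, sort [a, b, c] ! 1)"
    by (simp add: side_point_def Let_def a_def b_def c_def s_def u_def v_def w_def)
  ultimately have "side_point A B C \<in> moduli_triangles"
    using sum by (auto simp: moduli_triangles_def)
  then show ?thesis
    using moduli_point_eq[OF nc] T by simp
qed

lemma finite_lattice_triangles_upto: "finite (lattice_triangles_upto N)"
proof -
  have "finite ((\<int> \<inter> {- real N..real N}) \<times> (\<int> \<inter> {- real N..real N}))"
    using finite_abs_int_segment[where 'a = real, of "real N"]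
    by (intro finite_cartesian_product)
       (auto elim!: rev_finite_subset simp: abs_le_iff)
  then show ?thesis
    by (rule rev_finite_subset[OF finite_Pow_iff[THEN iffD2]])
       (auto simp: lattice_triangles_upto_def lattice_triangle_def)
qed

lemma count_triangle_classes:
  "count (triangle_classes N) p = card {T \<in> lattice_triangles_upto N. moduli_point T = p}"
proof -
  have "{T \<in> lattice_triangles_upto N. moduli_point T = p} =
      moduli_point -` {p} \<inter> lattice_triangles_upto N"
    by blast
  then show ?thesis
    by (simp add: triangle_classes_def count_image_mset finite_lattice_triangles_upto)
qed

lemma set_mset_triangle_classes: "set_mset (triangle_classes N) \<subseteq> moduli_triangles"
proof -
  have "moduli_point ` lattice_triangles_upto N \<subseteq> moduli_triangles"
    using moduli_point_in_moduli by (force simp: lattice_triangles_upto_def)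
  then show ?thesis
    by (simp add: triangle_classes_def finite_lattice_triangles_upto)
qed

lemma size_triangle_classes_at_top: "filterlim (\<lambda>N. size (triangle_classes N)) at_top at_top"
proof (rule filterlim_at_top_mono[OF filterlim_ident])
  have "N \<le> size (triangle_classes N)" for N
  proof -
    let ?f = "\<lambda>k. {(0, 0), (1, 0), (real k, 1)} :: (real \<times> real) set"
    have nc: "\<not> collinear (?f k)" for k
    proof
      assume "collinear (?f k)"
      then obtain u where u: "\<forall>x\<in>?f k. \<forall>y\<in>?f k. \<exists>c. x - y = c *\<^sub>R u"
        unfolding collinear_def ..
      have "\<exists>c. (1, 0) - (0, 0) = c *\<^sub>R u"
        by (rule u[rule_format]) simp_all
      moreover have "\<exists>d. (real k, 1) - (0, 0) = d *\<^sub>R u"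
        by (rule u[rule_format]) simp_all
      ultimately show False
        by (cases u) auto
    qed
    have "?f ` {1..N} \<subseteq> lattice_triangles_upto N"
    proof (rule image_subsetI)
      fix k assume k: "k \<in> {1..N}"
      have "\<exists>A B C. ?f k = {A, B, C}" by blast
      with nc k show "?f k \<in> lattice_triangles_upto N"
        by (simp add: lattice_triangles_upto_def lattice_triangle_def)
    qed
    moreover have "inj_on ?f {1..N}"
    proof (rule inj_onI)
      fix j k assume "?f j = ?f k"
      then have "(real j, 1) \<in> ?f k" by blast
      then show "j = k" by simp
    qed
    ultimately have "card {1..N} \<le> card (lattice_triangles_upto N)"
      by (metis card_image card_mono finite_lattice_triangles_upto)
    then show ?thesis
      by (simp add: triangle_classes_def)
  qed
  then show "\<forall>\<^sub>F N in sequentially. N \<le> size (triangle_classes N)"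
    by simp
qed

end

theory Submission
  imports Defs
begin

text \<open>
  A triangle of diameter comparable to \<open>1\<close>, with height at most \<open>h\<close> over its longest side and foot of
  the altitude away from the end points of that side, satisfies \<open>a + b - c = O(h\<^sup>2)\<close>.
  A positive proportion of order \<open>h\<close> of the lattice triangles in the square is that thin, but the
  region \<open>a + b - 1 = O(h\<^sup>2)\<close> of the moduli space only has area of order \<open>h\<^sup>2\<close>.
  For small \<open>h\<close> this is incompatible with equidistribution.
\<close>

section \<open>The thin part of the moduli space\<close>

text \<open>Since \<open>c = 2 - a - b\<close>, the bound amounts to
  \<open>a + b - c \<le> 2 * e\<close>: a strip along the edge \<open>a + b = 1\<close> of
  degenerate triangles.\<close>

definition thin_moduli :: "real \<Rightarrow> (real \<times> real) set" where
  "thin_moduli e = {p \<in> moduli_triangles. fst p + snd p \<le> 1 + e}"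

text \<open>As an intersection of half-planes the region is visibly convex and Borel, which is what
  makes it a planar domain.\<close>

lemma thin_moduli_halfspaces:
  "thin_moduli e = {p. (-1, 0) \<bullet> p < 0} \<inter> {p. (1, -1) \<bullet> p \<le> 0} \<inter> {p. (1, 2) \<bullet> p \<le> 2} \<inter>
     {p. (-1, -1) \<bullet> p < -1} \<inter> {p. (1, 1) \<bullet> p \<le> 1 + e}"
  by (auto simp: thin_moduli_def moduli_triangles_def)

lemma null_sets_frontier_convex:
  fixes S :: "'a::euclidean_space set"
  assumes "convex S"
  shows "frontier S \<in> null_sets lborel"
  using negligible_convex_frontier[OF assms] negligible_iff_null_sets null_sets_completion_iff
  by (metis borel_closed frontier_closed sets_lborel)

lemma planar_domain_thin_moduli: "planar_domain moduli_triangles (thin_moduli e)"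
proof -
  have "convex (thin_moduli e)"
    unfolding thin_moduli_halfspaces
    by (intro convex_Int convex_halfspace_lt convex_halfspace_le)
  moreover have "thin_moduli e \<in> sets borel"
    unfolding thin_moduli_halfspaces
    by (intro sets.Int borel_open open_halfspace_lt borel_closed closed_halfspace_le)
  ultimately show ?thesis
    by (auto simp: planar_domain_def null_sets_frontier_convex thin_moduli_def)
qed

lemma measure_thin_moduli_le:
  assumes "0 \<le> e"
  shows "measure lborel (thin_moduli e) \<le> e"
proof -
  \<comment> \<open>A parallelogram around the region: its vertical slices over
    \<open>[0, 1]\<close> have length \<open>e\<close>, so its area is \<open>e\<close> by
    Fubini.\<close>
  let ?Q = "{p :: real \<times> real. 0 \<le> fst p \<and> fst p \<le> 1 \<and> 1 - fst p \<le> snd p \<and> snd p \<le> 1 - fst p + e}"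
  have "closed ?Q"
    by (intro closed_Collect_conj closed_Collect_le continuous_intros)
  then have Q: "?Q \<in> sets borel" by (rule borel_closed)
  have "emeasure lborel (thin_moduli e) \<le> emeasure lborel ?Q"
    using Q by (intro emeasure_mono) (auto simp: thin_moduli_def moduli_triangles_def)
  also have "\<dots> = (\<integral>\<^sup>+x. emeasure lborel (Pair x -` ?Q) \<partial>lborel)"
    using Q by (subst lborel_prod[symmetric], subst lborel.emeasure_pair_measure_alt)
      (simp_all only: lborel_prod sets_lborel)
  also have "\<dots> \<le> (\<integral>\<^sup>+x. ennreal e * indicator {0..1::real} x \<partial>lborel)"
  proof (rule nn_integral_mono)
    fix x :: real
    have "Pair x -` ?Q = (if x \<in> {0..1} then {1 - x..1 - x + e} else {})"
      by auto
    then show "emeasure lborel (Pair x -` ?Q) \<le> ennreal e * indicator {0..1} x"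
      using assms by simp
  qed
  also have "\<dots> = ennreal e"
    by (simp add: nn_integral_cmult)
  finally show ?thesis
    using assms by (simp add: measure_def enn2real_leI)
qed

section \<open>Thin triangles\<close>

text \<open>The square root is concave, so it lies below its tangent at \<open>x^2\<close>; the
  square of the right side exceeds \<open>x^2 + d\<close> by \<open>(d / (2 * x))^2\<close>.\<close>

lemma sqrt_add_le:
  fixes x d :: real
  assumes "0 < x" "0 \<le> x\<^sup>2 + d"
  shows "sqrt (x\<^sup>2 + d) \<le> x + d / (2 * x)"
proof (rule real_le_lsqrt)
  have e: "x + d / (2 * x) = (2 * x\<^sup>2 + d) / (2 * x)"
    using assms by (simp add: field_simps power2_eq_square)
  show "0 \<le> x + d / (2 * x)"
    unfolding e using assms by (intro divide_nonneg_pos) (use zero_le_power2[of x] in linarith)+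
  have "(x + d / (2 * x))\<^sup>2 = x\<^sup>2 + d + (d / (2 * x))\<^sup>2"
    using assms by (simp add: power2_sum)
  then show "x\<^sup>2 + d \<le> (x + d / (2 * x))\<^sup>2" by simp
qed

text \<open>The terms of first order in the offset \<open>t\<close> of the middle vertex cancel.\<close>

lemma thin_excess:
  fixes u v s t M :: real
  assumes M: "0 < M" "M \<le> u" "M \<le> v"
  shows "sqrt (u\<^sup>2 + (s * u + t)\<^sup>2) + sqrt (v\<^sup>2 + (s * v - t)\<^sup>2)
           \<le> sqrt ((u + v)\<^sup>2 + (s * (u + v))\<^sup>2) + t\<^sup>2 / M"
proof -
  \<comment> \<open>A piece of the long side, of slope \<open>s\<close>, with horizontal extent
    \<open>x\<close> has length \<open>x * w\<close>.\<close>
  define w where "w = sqrt (1 + s\<^sup>2)"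
  have w: "1 \<le> w" "w\<^sup>2 = 1 + s\<^sup>2" by (simp_all add: w_def)
  \<comment> \<open>The tangent bound at the length \<open>x * w\<close>; the quadratic term is then
    bounded using \<open>x \<ge> M\<close> and \<open>w \<ge> 1\<close>.\<close>
  have *: "sqrt (x\<^sup>2 + (s * x + r)\<^sup>2) \<le> x * w + s * r / w + r\<^sup>2 / (2 * M)"
    if "M \<le> x" for x r
  proof -
    have eq: "x\<^sup>2 + (s * x + r)\<^sup>2 = (x * w)\<^sup>2 + (2 * s * x * r + r\<^sup>2)"
      using w by (simp add: power_mult_distrib power2_sum algebra_simps)
    have "sqrt (x\<^sup>2 + (s * x + r)\<^sup>2) \<le> x * w + (2 * s * x * r + r\<^sup>2) / (2 * (x * w))"
      unfolding eq
    proof (rule sqrt_add_le)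
      show "0 < x * w" using that M w by (intro mult_pos_pos) auto
      show "0 \<le> (x * w)\<^sup>2 + (2 * s * x * r + r\<^sup>2)" by (simp flip: eq)
    qed
    also have "\<dots> = x * w + s * r / w + r\<^sup>2 / (2 * (x * w))"
      using that M w by (simp add: field_simps)
    also have "r\<^sup>2 / (2 * (x * w)) \<le> r\<^sup>2 / (2 * M)"
      using that M w mult_mono[of M x 1 w] by (intro divide_left_mono) auto
    finally show ?thesis by simp
  qed
  have "(u + v)\<^sup>2 + (s * (u + v))\<^sup>2 = ((u + v) * w)\<^sup>2"
    unfolding power_mult_distrib w(2) by algebra
  then have "sqrt ((u + v)\<^sup>2 + (s * (u + v))\<^sup>2) = sqrt (((u + v) * w)\<^sup>2)"
    by simp
  also have "\<dots> = (u + v) * w"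
    using M w by simp
  finally show ?thesis
    \<comment> \<open>The offsets \<open>t\<close> and \<open>- t\<close> cancel the linear terms,
      and the two quadratic terms add up to \<open>t^2 / M\<close>.\<close>
    using *[of u t] *[of v "- t"] M by (simp add: algebra_simps)
qed

text \<open>Here \<open>t\<close> is the vertical offset of \<open>B\<close> from the line
  \<open>AC\<close>. The excess \<open>p + q - r\<close> is at most \<open>t^2 / M\<close>, and
  normalizing divides it by a half-perimeter of order at least \<open>M\<close>.\<close>

lemma thin_triangle:
  fixes A B C :: "real \<times> real"
  assumes M: "0 < M" "M \<le> fst B - fst A" "M \<le> fst C - fst B"
    and t: "snd B = snd A + (snd C - snd A) * (fst B - fst A) / (fst C - fst A) + t" "t \<noteq> 0"
  shows not_collinear_thin: "\<not> collinear {A, B, C}"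
    and side_point_thin: "fst (side_point A B C) + snd (side_point A B C) \<le> 1 + t\<^sup>2 / M\<^sup>2"
proof -
  define u v s where "u = fst B - fst A" and "v = fst C - fst B"
    and "s = (snd C - snd A) / (fst C - fst A)"
  have uv: "M \<le> u" "M \<le> v" "u + v = fst C - fst A"
    using M by (simp_all add: u_def v_def)
  have B: "snd B - snd A = s * u + t" using t by (simp add: s_def u_def)
  have AC: "snd C - snd A = s * (u + v)" using uv M by (simp add: s_def)
  then have C: "snd C - snd B = s * v - t" using B by (simp add: algebra_simps)
  show "\<not> collinear {A, B, C}"
  proof
    \<comment> \<open>The horizontal coordinates determine \<open>k\<close>; the vertical ones then
      force the offset \<open>t\<close> to vanish.\<close>
    assume "collinear {A, B, C}"
    then obtain k where k: "B = k *\<^sub>R A + (1 - k) *\<^sub>R C"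
      using M by (auto simp: collinear_3_expand)
    then have "fst B = k * fst A + (1 - k) * fst C" "snd B = k * snd A + (1 - k) * snd C"
      by simp_all
    then have "u = (1 - k) * (u + v)" and "snd B - snd A = (1 - k) * (snd C - snd A)"
      unfolding uv(3) by (simp_all add: u_def algebra_simps)
    then have "s * u + t = s * u" using AC B by (metis mult.left_commute)
    then show False using t by simp
  qed
  define p q r where "p = norm (B - A)" and "q = norm (C - B)" and "r = norm (A - C)"
  have pq: "p + q \<le> r + t\<^sup>2 / M"
    using thin_excess[OF M(1) uv(1,2), of s t] unfolding p_def q_def r_def norm_minus_commute[of A C]
    by (simp add: norm_prod_def B C AC uv(3) flip: u_def v_def)
  have "\<bar>fst C - fst A\<bar> \<le> norm (C - A)"
    unfolding norm_prod_def fst_diff by (intro real_le_rsqrt) simp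
  then have r: "2 * M \<le> r"
    using uv M by (simp add: r_def norm_minus_commute)
  have "r \<le> p + q"
    using norm_triangle_ineq[of "B - A" "C - B"]
    by (simp add: p_def q_def r_def norm_minus_commute[of A C])
  define S where "S = (p + q + r) / 2"
  have S: "2 * M \<le> S" using r \<open>r \<le> p + q\<close> by (simp add: S_def)
  \<comment> \<open>After sorting, the first two entries have a sum at most that of any two
    sides.\<close>
  have "fst (side_point A B C) + snd (side_point A B C) \<le> p / S + q / S"
    by (auto simp: side_point_def Let_def S_def p_def q_def r_def)
  also have "\<dots> = (S + (p + q - r) / 2) / S"
  proof -
    have "p + q = S + (p + q - r) / 2"
      unfolding S_def by argo
    then show ?thesis
      by (metis add_divide_distrib)
  qed
  also have "\<dots> = 1 + ((p + q - r) / 2) / S"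
    using S M by (simp add: add_divide_distrib)
  also have "((p + q - r) / 2) / S \<le> (t\<^sup>2 / M) / M"
  proof (rule frac_le)
    have "(p + q - r) / 2 \<le> p + q - r"
      using \<open>r \<le> p + q\<close> by simp
    also have "\<dots> \<le> t\<^sup>2 / M"
      using pq by (simp only: diff_le_eq add.commute)
    finally show "(p + q - r) / 2 \<le> t\<^sup>2 / M" .
  qed (use S M in auto)
  finally show "fst (side_point A B C) + snd (side_point A B C) \<le> 1 + t\<^sup>2 / M\<^sup>2"
    by (simp add: power2_eq_square)
qed

section \<open>Counting\<close>

lemma dirac_measure_eq_size_filter: "dirac_measure S A = real (size {#p \<in># S. p \<in> A#})"
proof -
  have "size {#p \<in># S. p \<in> A#} = (\<Sum>p\<in>set_mset S. count {#p \<in># S. p \<in> A#} p)"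
    unfolding size_multiset_overloaded_eq by (rule sum.mono_neutral_left) (auto simp: not_in_iff)
  also have "real \<dots> = dirac_measure S A"
    unfolding dirac_measure_def of_nat_sum by (intro sum.cong) auto
  finally show ?thesis by simp
qed

text \<open>Turns weighted masses into plain counts of triangles.\<close>

lemma dirac_measure_triangle_classes:
  "dirac_measure (triangle_classes N) A = card {T \<in> lattice_triangles_upto N. moduli_point T \<in> A}"
  by (simp add: dirac_measure_eq_size_filter triangle_classes_def filter_mset_image_mset
      finite_lattice_triangles_upto)

text \<open>Every triangle comes from an ordered triple of points of a grid with
  \<open>(2 * N + 1)^2\<close> elements; only the order \<open>N^6\<close> matters.\<close>

lemma size_triangle_classes_le: "size (triangle_classes N) \<le> (2 * N + 1) ^ 6"
proof -
  define I where "I = {- int N..int N}"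
  define G where "G = (\<lambda>(x, y). (real_of_int x, real_of_int y)) ` (I \<times> I)"
  have cardI: "card I = 2 * N + 1" by (simp add: I_def)
  have G: "finite G" "card G \<le> (2 * N + 1) ^ 2"
    using card_image_le[of "I \<times> I" "\<lambda>(x, y). (real_of_int x, real_of_int y)"] cardI
    by (simp_all add: G_def I_def card_cartesian_product power2_eq_square)
  have "lattice_triangles_upto N \<subseteq> (\<lambda>(A, B, C). {A, B, C}) ` (G \<times> G \<times> G)"
  proof
    fix T assume T: "T \<in> lattice_triangles_upto N"
    have "T \<subseteq> G"
    proof
      fix p assume "p \<in> T"
      then have "p \<in> \<int> \<times> \<int>" "p \<in> {- real N..real N} \<times> {- real N..real N}"
        using T by (auto simp: lattice_triangles_upto_def lattice_triangle_def)
      then obtain x y where p: "p = (real_of_int x, real_of_int y)"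
        and *: "- real N \<le> x" "x \<le> real N" "- real N \<le> y" "y \<le> real N"
        by (auto elim!: Ints_cases)
      from * have "x \<in> I" "y \<in> I" unfolding I_def atLeastAtMost_iff by linarith+
      then show "p \<in> G" unfolding G_def p by (intro image_eqI[of _ _ "(x, y)"]) auto
    qed
    moreover obtain A B C where "T = {A, B, C}"
      using T by (auto simp: lattice_triangles_upto_def lattice_triangle_def)
    ultimately show "T \<in> (\<lambda>(A, B, C). {A, B, C}) ` (G \<times> G \<times> G)"
      by (intro image_eqI[of _ _ "(A, B, C)"]) auto
  qed
  then have "card (lattice_triangles_upto N) \<le> card (G \<times> G \<times> G)"
    using G by (intro surj_card_le) auto
  also have "\<dots> = card G ^ 3"
    by (simp add: card_cartesian_product power3_eq_cube)
  also have "\<dots> \<le> ((2 * N + 1) ^ 2) ^ 3"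
    using G by (intro power_mono) auto
  finally show ?thesis
    by (simp add: triangle_classes_def flip: power_mult)
qed

lemma card_thin_triangles_ge:
  fixes m M :: nat
  assumes m: "0 < m" "m \<le> M"
  shows "M ^ 5 * m \<le> card {T \<in> lattice_triangles_upto (3 * M).
           moduli_point T \<in> thin_moduli ((real m / real M)\<^sup>2)}" (is "_ \<le> card ?X")
proof -
  \<comment> \<open>The three abscissae range over disjoint strips of width \<open>M\<close> that
    are at least \<open>M\<close> apart. Five coordinates have \<open>M\<close> choices each, the
    last has \<open>m\<close>.\<close>
  define P where "P = {- 2 * int M..<- int M} \<times> {0..<int M} \<times> {0..<int M} \<times> {2 * int M..<3 * int M}
      \<times> {0..<int M} \<times> {1..int m}"
  text \<open>The last coordinate is the height of the middle vertex above the opposite side, rounded up.\<close>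
  define yb where "yb = (\<lambda>(xa, ya, xb, xc, yc, j).
      ya + (yc - ya) * (xb - xa) div (xc - xa) + j :: int)"
  define f where "f = (\<lambda>(xa, ya, xb, xc, yc, j).
      {(real_of_int xa, real_of_int ya), (real_of_int xb, real_of_int (yb (xa, ya, xb, xc, yc, j))),
       (real_of_int xc, real_of_int yc)})"
  have "inj_on f P"
  proof (rule inj_onI)
    fix z z' assume z: "z \<in> P" "z' \<in> P" and eq: "f z = f z'"
    obtain xa ya xb xc yc j where zz: "z = (xa, ya, xb, xc, yc, j)" by (cases z) auto
    obtain xa' ya' xb' xc' yc' j' where zz': "z' = (xa', ya', xb', xc', yc', j')" by (cases z') auto
    define A B C A' B' C' where "A = (real_of_int xa, real_of_int ya)"
      and "B = (real_of_int xb, real_of_int (yb z))" and "C = (real_of_int xc, real_of_int yc)"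
      and "A' = (real_of_int xa', real_of_int ya')"
      and "B' = (real_of_int xb', real_of_int (yb z'))" and "C' = (real_of_int xc', real_of_int yc')"
    note defs = this
    have r: "xa < 0" "0 \<le> xb" "xb < int M" "2 * int M \<le> xc"
      "xa' < 0" "0 \<le> xb'" "xb' < int M" "2 * int M \<le> xc'"
      using z by (auto simp: P_def zz zz')
    have "{A, B, C} = {A', B', C'}"
      using eq by (simp add: f_def zz zz' defs)
    \<comment> \<open>Disjoint strips let the abscissa identify each vertex, so the unordered
      triangle determines its parameters.\<close>
    moreover have "A \<noteq> B'" "A \<noteq> C'" "B \<noteq> A'" "B \<noteq> C'" "C \<noteq> A'" "C \<noteq> B'"
      using r by (auto simp: defs)
    ultimately have "A = A'" "B = B'" "C = C'" by auto
    then show "z = z'" by (auto simp: defs zz zz' yb_def)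
  qed
  moreover have "f ` P \<subseteq> ?X"
  proof (rule image_subsetI)
    fix z assume z: "z \<in> P"
    obtain xa ya xb xc yc j where zz: "z = (xa, ya, xb, xc, yc, j)" by (cases z) auto
    define A B C where "A = (real_of_int xa, real_of_int ya)"
      and "B = (real_of_int xb, real_of_int (yb z))" and "C = (real_of_int xc, real_of_int yc)"
    have f: "f z = {A, B, C}" by (simp add: f_def zz A_def B_def C_def)
    have r: "- 2 * int M \<le> xa" "xa < - int M" "0 \<le> ya" "ya < int M" "0 \<le> xb" "xb < int M"
      "2 * int M \<le> xc" "xc < 3 * int M" "0 \<le> yc" "yc < int M" "1 \<le> j" "j \<le> int m"
      using z by (auto simp: P_def zz)
    define c d where "c = (yc - ya) * (xb - xa)" and "d = xc - xa"
    have d: "0 < d" using r by (simp add: d_def)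
    have yb: "yb z = ya + c div d + j" by (simp add: yb_def zz c_def d_def)
    \<comment> \<open>The true offset is \<open>j\<close> minus the fractional part of
      \<open>c / d\<close>. Starting \<open>j\<close> at 1 keeps it positive, hence the triangle
      nondegenerate.\<close>
    define t where "t = real_of_int j - (real_of_int c / real_of_int d - real_of_int (c div d))"
    have fl: "real_of_int (c div d) = real_of_int \<lfloor>real_of_int c / real_of_int d\<rfloor>"
      by (simp add: floor_divide_of_int_eq)
    have t: "0 < t" "t \<le> real m"
      unfolding t_def fl using r by linarith+
    have "real_of_int (yb z) = real_of_int ya + real_of_int c / real_of_int d + t"
      by (simp add: yb t_def)
    then have B: "snd B = snd A + (snd C - snd A) * (fst B - fst A) / (fst C - fst A) + t"
      by (simp add: A_def B_def C_def c_def d_def)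
    have M: "0 < real M" "real M \<le> fst B - fst A" "real M \<le> fst C - fst B"
      using m r by (simp_all add: A_def B_def C_def)
    have "t \<noteq> 0" using t by simp
    note thin = thin_triangle[OF M B this]
    have lat: "lattice_triangle (f z)"
      unfolding f lattice_triangle_def
    proof (intro conjI exI)
      show "{A, B, C} \<subseteq> \<int> \<times> \<int>" by (simp add: A_def B_def C_def)
    qed (use thin(1) in auto)
    \<comment> \<open>The point of \<open>AC\<close> below \<open>B\<close> has height in
      \<open>[0, M]\<close>, as does its floor; adding \<open>j \<le> m \<le> M\<close> stays within
      \<open>2 * M\<close>.\<close>
    have "c \<le> (int M - ya) * d" "- ya * d \<le> c"
    proof -
      have "c \<le> (int M - ya) * (xb - xa)" unfolding c_def using r by (intro mult_right_mono) auto
      also have "\<dots> \<le> (int M - ya) * d" unfolding d_def using r by (intro mult_left_mono) auto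
      finally show "c \<le> (int M - ya) * d" .
      have "ya * (xb - xa) \<le> ya * d" unfolding d_def using r by (intro mult_left_mono) auto
      moreover have "- ya * (xb - xa) \<le> c" unfolding c_def using r by (intro mult_right_mono) auto
      ultimately show "- ya * d \<le> c" by simp
    qed
    then have "c div d \<le> int M - ya" "- ya \<le> c div d"
      using d zdiv_mono1[of c "(int M - ya) * d" d] zdiv_mono1[of "- ya * d" c d]
      by (simp_all del: mult_minus_left)
    then have "0 \<le> yb z" "yb z \<le> 2 * int M" using r m by (simp_all add: yb)
    then have box: "f z \<subseteq> {- real (3 * M)..real (3 * M)} \<times> {- real (3 * M)..real (3 * M)}"
      unfolding f A_def B_def C_def using r by simp
    have "t\<^sup>2 / (real M)\<^sup>2 \<le> (real m / real M)\<^sup>2"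
      using t by (auto simp: power_divide intro!: divide_right_mono power_mono)
    then have "moduli_point (f z) \<in> thin_moduli ((real m / real M)\<^sup>2)"
      using thin moduli_point_in_moduli[OF lat] by (simp add: thin_moduli_def f moduli_point_eq)
    with lat box show "f z \<in> ?X" by (simp add: lattice_triangles_upto_def)
  qed
  moreover have "finite ?X" by (simp add: finite_lattice_triangles_upto)
  ultimately have "card P \<le> card ?X" by (rule card_inj_on_le)
  moreover have "card P = M ^ 5 * m"
    by (simp add: P_def card_cartesian_product eval_nat_numeral)
  ultimately show ?thesis by simp
qed

text \<open>With \<open>M = K * m\<close> the thinness \<open>m / M = 1 / K\<close> stays fixed
  while \<open>m\<close>, and so the square, grows. The proportion is at least
  \<open>M^5 * m / (7 * M)^6\<close>.\<close>

lemma thin_proportion_ge: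
  fixes m K :: nat
  assumes "0 < m" "0 < K"
  defines "N \<equiv> 3 * (K * m)"
  shows "1 / (7 ^ 6 * real K)
    \<le> 1 / real (size (triangle_classes N)) *
        dirac_measure (triangle_classes N) (thin_moduli ((1 / real K)\<^sup>2))"
    (is "_ \<le> 1 / real ?s * ?d")
proof -
  define M where "M = K * m"
  have M: "0 < M" "m \<le> M" "N = 3 * M" using assms by (simp_all add: M_def)
  have "real m / real M = 1 / real K" using assms by (simp add: M_def)
  then have d: "real (M ^ 5 * m) \<le> ?d"
    using card_thin_triangles_ge[OF assms(1) M(2)]
    by (simp only: dirac_measure_triangle_classes M(3) of_nat_le_iff)
  have "?s \<le> (2 * N + 1) ^ 6" by (rule size_triangle_classes_le)
  \<comment> \<open>\<open>2 * N + 1 = 6 * M + 1 \<le> 7 * M\<close>.\<close>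
  also have "\<dots> \<le> (7 * M) ^ 6" using M by (intro power_mono) auto
  finally have s: "real ?s \<le> (7 * real M) ^ 6"
    by (metis of_nat_le_iff of_nat_mult of_nat_numeral of_nat_power)
  have "?d \<le> real ?s"
    unfolding dirac_measure_eq_size_filter by (simp add: size_filter_mset_lesseq)
  moreover have "0 < real (M ^ 5 * m)"
    using M assms by simp
  ultimately have pos: "0 < real ?s" using d by linarith
  have "1 / (7 ^ 6 * real K) = real (M ^ 5 * m) / (7 * real M) ^ 6"
    using assms by (simp add: M_def field_simps eval_nat_numeral)
  also have "\<dots> \<le> ?d / real ?s"
    using d s pos \<open>0 < real (M ^ 5 * m)\<close> by (intro frac_le) linarith+
  finally show ?thesis by simp
qed

theorem theorem1p2:
  shows "\<not> equidistributes (\<lambda>n. triangle_classes (Suc n)) moduli_triangles"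
proof
  assume eq: "equidistributes (\<lambda>n. triangle_classes (Suc n)) moduli_triangles"
  define q where "q = measure lborel moduli_triangles"
  \<comment> \<open>The limiting proportion is at least \<open>1 / (7^6 * K)\<close> but the area
    fraction at most \<open>1 / (K^2 * q)\<close>, which bounds \<open>K\<close>. The case
    \<open>q = 0\<close> is covered: as \<open>x / 0 = 0\<close>, the bound then fails for positive
    \<open>K\<close>.\<close>
  have *: "real K \<le> 7 ^ 6 / q" if K: "0 < K" for K :: nat
  proof -
    define e where "e = (1 / real K)\<^sup>2"
    define h where "h = (\<lambda>n. 1 / real (size (triangle_classes (Suc n))) *
      dirac_measure (triangle_classes (Suc n)) (thin_moduli e))"
    have "h \<longlonglongrightarrow> measure lborel (thin_moduli e) / q"
      using eq planar_domain_thin_moduli unfolding equidistributes_def h_def q_def by blast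
    \<comment> \<open>Passes to the subsequence of sizes \<open>3 * K * (m + 1)\<close>; the
      \<open>- 1\<close> undoes the shift by \<open>Suc\<close> in the indexing.\<close>
    moreover have "strict_mono (\<lambda>m. 3 * (K * Suc m) - 1)"
      using K by (intro strict_monoI) (simp add: diff_less_mono)
    ultimately have "(\<lambda>m. h (3 * (K * Suc m) - 1)) \<longlonglongrightarrow> measure lborel (thin_moduli e) / q"
      using LIMSEQ_subseq_LIMSEQ by (fastforce simp: o_def)
    moreover have "1 / (7 ^ 6 * real K) \<le> h (3 * (K * Suc m) - 1)" for m
    proof -
      have "Suc (3 * (K * Suc m) - 1) = 3 * (K * Suc m)" using K by simp
      then show ?thesis
        unfolding h_def e_def using thin_proportion_ge[OF zero_less_Suc K] by metis
    qed
    ultimately have "1 / (7 ^ 6 * real K) \<le> measure lborel (thin_moduli e) / q"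
      by (intro LIMSEQ_le_const) auto
    also have "\<dots> \<le> e / q"
      by (intro divide_right_mono measure_thin_moduli_le) (auto simp: q_def e_def)
    finally have "(7 ^ 6 * (real K)\<^sup>2) * (1 / (7 ^ 6 * real K)) \<le> (7 ^ 6 * (real K)\<^sup>2) * (e / q)"
      by (intro mult_left_mono) auto
    then show ?thesis
      using K by (simp add: e_def power2_eq_square)
  qed
  obtain K :: nat where "7 ^ 6 / q < real K" using reals_Archimedean2 by blast
  with *[of "Suc K"] show False by simp
qed

end
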